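(* Let $F:2^{[n]}\to\mathbb{R}$ be submodular with $F(\emptyset)=0$, let $\emptyset\ne\mathcal{V}\subseteq\mathrm{vert}(B(F))$, and let $g:\mathbb{R}^n\to\mathbb{R}$ be strongly convex. If $w^\star$ is an optimal solution of $$\text{maximize } -g^*(-w)\quad\text{subject to } w\in\mathrm{conv}(\mathcal{V}),$$ then $x^\star=(\partial g)^{-1}(-w^\star)=\nabla g^*(-w^\star)$ is an optimal solution (with $t=\max_{v\in\mathcal{V}}v^\top x^\star$) of $$\text{minimize } g(x)+t\quad\text{subject to } t\ge v^\top x,\ v\in\mathcal{V}.$$ If in addition $g$ is smooth and $x^\star$ solves the latter (primal) problem, then $w^\star=-\nabla g(x^\star)$ solves the former (dual) problem.
   Context: $[n]=\{1,\dots,n\}$. $F$ is submodular if $F(A)+F(B)\ge F(A\cup B)+F(A\cap B)$ for all $A,B\subseteq[n]$. With $w(A)=\sum_{k\in A}w_k$, the base polytope is $B(F)=\{w\in\mathbb{R}^n: w(A)\le F(A)\ \forall A\subseteq[n],\ w([n])=F([n])\}$, with vertex set $\mathrm{vert}(B(F))$. $g^*(w)=\max_{x\in\mathbb{R}^n}w^\top x-g(x)$ is the Fenchel conjugate. Strongly convex: $g-\frac{\alpha}{2}\|\cdot\|_2^2$ is convex for some $\alpha>0$. Smooth: $g-\frac{\beta}{2}\|\cdot\|_2^2$ is concave for some $\beta>0$. *)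

theory Defs
  imports "HOL-Analysis.Analysis"
begin

definition submodular :: "('n::finite set \<Rightarrow> real) \<Rightarrow> bool" where
  "submodular F \<longleftrightarrow> (\<forall>A B. F A + F B \<ge> F (A \<union> B) + F (A \<inter> B))"

definition base_polytope :: "('n::finite set \<Rightarrow> real) \<Rightarrow> (real ^ 'n) set" where
  "base_polytope F =
    {w. (\<forall>A. (\<Sum>k\<in>A. w $ k) \<le> F A) \<and> (\<Sum>k\<in>UNIV. w $ k) = F UNIV}"

definition vert :: "'a::real_vector set \<Rightarrow> 'a set" where
  "vert P = {v. v extreme_point_of P}"

definition strongly_convex :: "('a::real_inner \<Rightarrow> real) \<Rightarrow> bool" where
  "strongly_convex g \<longleftrightarrow> (\<exists>\<alpha>>0. convex_on UNIV (\<lambda>x. g x - \<alpha> / 2 * (norm x)\<^sup>2))"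

definition smooth :: "('a::real_inner \<Rightarrow> real) \<Rightarrow> bool" where
  "smooth g \<longleftrightarrow> (\<exists>\<beta>>0. concave_on UNIV (\<lambda>x. g x - \<beta> / 2 * (norm x)\<^sup>2))"

text \<open>A genuine maximum, not a supremum: the value is unspecified where the maximum is not
  attained. For strongly convex functions on a Euclidean space it is attained at every point.\<close>
definition fenchel_conjugate :: "('a::real_inner \<Rightarrow> real) \<Rightarrow> 'a \<Rightarrow> real" where
  "fenchel_conjugate g w = (GREATEST m. \<exists>x. m = w \<bullet> x - g x)"

definition subdifferential :: "('a::real_inner \<Rightarrow> real) \<Rightarrow> 'a \<Rightarrow> 'a set" where
  "subdifferential g x = {s. \<forall>y. g y \<ge> g x + s \<bullet> (y - x)}"

text \<open>The inverse of the set-valued map \<open>subdifferential g\<close>, again set-valued.\<close>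
definition inv_subdifferential :: "('a::real_inner \<Rightarrow> real) \<Rightarrow> 'a \<Rightarrow> 'a set" where
  "inv_subdifferential g s = {x. s \<in> subdifferential g x}"

definition dual_optimal :: "('a::real_inner \<Rightarrow> real) \<Rightarrow> 'a set \<Rightarrow> 'a \<Rightarrow> bool" where
  "dual_optimal g V = is_arg_max (\<lambda>w. - fenchel_conjugate g (- w)) (\<lambda>w. w \<in> convex hull V)"

definition primal_optimal :: "('a::real_inner \<Rightarrow> real) \<Rightarrow> 'a set \<Rightarrow> 'a \<times> real \<Rightarrow> bool" where
  "primal_optimal g V = is_arg_min (\<lambda>(x, t). g x + t) (\<lambda>(x, t). \<forall>v\<in>V. t \<ge> v \<bullet> x)"

end

theory Submission
  imports Defs
begin

text \<open>For a strongly convex \<open>g\<close> the subdifferential has a single-valued Lipschitz inverse, and comparing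
  subgradients at two points squeezes the first-order remainder of \<open>g\<^sup>*\<close> between \<open>0\<close> and a quadratic.
  The variational inequality of a dual optimum \<open>w\<close> then says that \<open>w\<close> maximizes \<open>u \<bullet> x\<close> over the
  convex hull, where \<open>- w \<in> \<partial>g(x)\<close>; the subgradient inequality at \<open>x\<close> yields primal optimality, even with
  quadratic growth, so the primal solution is unique. Conversely a dual optimum exists by compactness
  (a polyhedron has finitely many vertices), so the primal solution \<open>x\<close> comes with a subgradient \<open>- w\<close>
  where \<open>w\<close> is dual optimal, and smoothness forces this subgradient to be the gradient.\<close>

section \<open>Limits and derivatives from quadratic error terms\<close>

text \<open>Let \<open>t\<close> tend to 0 from the right. This finishes arguments in which an
  inequality along a segment is divided by the step length \<open>t\<close>.\<close>

lemma nonpos_if_le_small_multiples: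
  fixes a b :: real
  assumes "\<And>t. 0 < t \<Longrightarrow> t < 1 \<Longrightarrow> a \<le> t * b"
  shows "a \<le> 0"
proof (rule tendsto_lowerbound)
  show "((\<lambda>t. t * b) \<longlongrightarrow> 0) (at_right 0)"
    by (auto intro!: tendsto_eq_intros)
  show "eventually (\<lambda>t. a \<le> t * b) (at_right 0)"
    using eventually_at_right_less[of "0::real"] eventually_at_right_real[OF zero_less_one]
    by eventually_elim (use assms in auto)
qed simp

lemma GDERIV_if_quadratic_remainder:
  fixes f :: "'a::real_inner \<Rightarrow> real"
  assumes bound: "\<And>h. \<bar>f (x + h) - f x - h \<bullet> D\<bar> \<le> c * (norm h)\<^sup>2"
  shows "GDERIV f x :> D"
  unfolding gderiv_def has_derivative_iff_norm
proof
  show "bounded_linear (\<lambda>h. h \<bullet> D)"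
    by (rule bounded_linear_inner_left)
  show "((\<lambda>y. norm (f y - f x - (y - x) \<bullet> D) / norm (y - x)) \<longlongrightarrow> 0) (at x)"
  proof (rule tendsto_sandwich[where f = "\<lambda>_. 0" and h = "\<lambda>y. c * norm (y - x)"])
    show "((\<lambda>y. c * norm (y - x)) \<longlongrightarrow> 0) (at x)"
      by (auto intro!: tendsto_eq_intros)
    have "norm (f y - f x - (y - x) \<bullet> D) / norm (y - x) \<le> c * norm (y - x)" if "y \<noteq> x" for y
      using bound[of "y - x"] that by (simp add: divide_simps power2_eq_square mult.assoc)
    then show "\<forall>\<^sub>F y in at x. norm (f y - f x - (y - x) \<bullet> D) / norm (y - x) \<le> c * norm (y - x)"
      by (auto simp: eventually_at_filter)
  qed auto
qed

section \<open>Strong convexity: subgradients and their inverse\<close>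

lemma norm_convex_combination:
  fixes x y :: "'a::real_inner"
  shows "(norm ((1 - t) *\<^sub>R x + t *\<^sub>R y))\<^sup>2 =
    (1 - t) * (norm x)\<^sup>2 + t * (norm y)\<^sup>2 - t * (1 - t) * (norm (y - x))\<^sup>2"
  unfolding power2_norm_eq_inner
  by (simp add: inner_simps inner_commute[of y x] algebra_simps)

text \<open>The sign of \<open>\<alpha>\<close> is left free, so that a negative modulus can later
  express smoothness.\<close>

lemma strongly_convex_onD:
  fixes g :: "'a::real_inner \<Rightarrow> real"
  assumes "convex_on UNIV (\<lambda>x. g x - \<alpha> / 2 * (norm x)\<^sup>2)" "0 \<le> t" "t \<le> 1"
  shows "g ((1 - t) *\<^sub>R x + t *\<^sub>R y) \<le>
    (1 - t) * g x + t * g y - \<alpha> / 2 * (t * (1 - t) * (norm (y - x))\<^sup>2)"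
proof -
  have "g ((1 - t) *\<^sub>R x + t *\<^sub>R y) - \<alpha> / 2 * (norm ((1 - t) *\<^sub>R x + t *\<^sub>R y))\<^sup>2 \<le>
      (1 - t) * (g x - \<alpha> / 2 * (norm x)\<^sup>2) + t * (g y - \<alpha> / 2 * (norm y)\<^sup>2)"
    using convex_onD[OF assms(1), of t x y] assms(2,3) by simp
  then show ?thesis
    unfolding norm_convex_combination
    by (simp add: algebra_simps add_divide_distrib diff_divide_distrib)
qed

text \<open>Beyond the unit sphere, convexity on the segment from 0 to \<open>x\<close> bounds
  \<open>k x\<close> below through the values at 0 and at the unit vector in direction
  \<open>x\<close>; these are bounded by compactness of the unit ball.\<close>

lemma convex_on_linear_lower_bound:
  fixes k :: "'a::euclidean_space \<Rightarrow> real"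
  assumes convex: "convex_on UNIV k"
  obtains C where "\<And>x. 1 \<le> norm x \<Longrightarrow> - C * norm x \<le> k x"
proof -
  have "continuous_on UNIV k"
    using convex by (intro convex_on_continuous) auto
  then have "compact (k ` cball 0 1)"
    by (intro compact_continuous_image) (auto intro: continuous_on_subset)
  then obtain M where M: "\<And>x. norm x \<le> 1 \<Longrightarrow> \<bar>k x\<bar> \<le> M"
    by (force dest!: compact_imp_bounded simp: bounded_iff)
  \<comment> \<open>One \<open>M\<close> bounds \<open>k\<close> from below at the unit vector, the
    other bounds the share of \<open>k 0\<close> from above.\<close>
  have "- (2 * M) * norm x \<le> k x" if "1 \<le> norm x" for x
  proof -
    let ?r = "norm x"
    have r: "0 < ?r" "0 \<le> 1 / ?r" "1 / ?r \<le> 1"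
      using that by (auto simp: divide_le_eq_1)
    have "k ((1 / ?r) *\<^sub>R x) \<le> (1 - 1 / ?r) * k 0 + (1 / ?r) * k x"
      using convex_onD[OF convex r(2,3), of 0 x] by simp
    moreover have "- M \<le> k ((1 / ?r) *\<^sub>R x)"
      using M[of "(1 / ?r) *\<^sub>R x"] r by simp
    moreover have "(1 - 1 / ?r) * k 0 \<le> M"
    proof -
      have "k 0 \<le> M" "0 \<le> M"
        using M[of 0] by auto
      then have "(1 - 1 / ?r) * k 0 \<le> (1 - 1 / ?r) * M" "(1 - 1 / ?r) * M \<le> M"
        using r by (auto intro!: mult_left_mono mult_left_le_one_le)
      then show ?thesis
        by linarith
    qed
    ultimately have "- (2 * M) \<le> k x / ?r"
      by simp
    then show ?thesis
      using r(1) by (simp add: pos_le_divide_eq)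
  qed
  then show ?thesis
    using that by blast
qed

text \<open>A subgradient \<open>s\<close> at \<open>x\<close> means that \<open>x\<close> minimizes
  \<open>g x - s \<bullet> x\<close>. The quadratic part of \<open>g\<close> outgrows all linear
  terms, so a minimizer over a large ball is global.\<close>

lemma subdifferential_surj:
  fixes g :: "'a::euclidean_space \<Rightarrow> real"
  assumes convex: "convex_on UNIV (\<lambda>x. g x - \<alpha> / 2 * (norm x)\<^sup>2)" and "\<alpha> > 0"
  obtains x where "s \<in> subdifferential g x"
proof -
  let ?k = "\<lambda>x. g x - \<alpha> / 2 * (norm x)\<^sup>2"
  let ?h = "\<lambda>x. g x - s \<bullet> x"
  obtain C where C: "\<And>x. 1 \<le> norm x \<Longrightarrow> - C * norm x \<le> ?k x"
    using convex_on_linear_lower_bound[OF convex] by blast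
  \<comment> \<open>\<open>D\<close> gathers everything that the quadratic must dominate: outside
    radius \<open>R\<close> it is at most \<open>\<alpha> / 2 * norm x\<close>. The summand 1 in
    \<open>R\<close> keeps \<open>norm x\<close> in the range where \<open>C\<close>
    applies.\<close>
  define D where "D = \<bar>C\<bar> + norm s + \<bar>g 0\<bar>"
  define R where "R = 1 + 2 * D / \<alpha>"
  have "R \<ge> 1"
    using \<open>\<alpha> > 0\<close> by (simp add: R_def D_def)
  have outside: "?h 0 \<le> ?h x" if "R \<le> norm x" for x
  proof -
    have n: "1 \<le> norm x"
      using that \<open>R \<ge> 1\<close> by simp
    have "\<bar>C\<bar> + norm s + \<bar>g 0\<bar> \<le> \<alpha> / 2 * norm x"
    proof -
      have "2 * D / \<alpha> \<le> norm x"
        using that by (simp add: R_def)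
      then show ?thesis
        using \<open>\<alpha> > 0\<close> by (simp add: D_def divide_simps mult.commute)
    qed
    then have "(\<bar>C\<bar> + norm s + \<bar>g 0\<bar>) * norm x \<le> \<alpha> / 2 * norm x * norm x"
      by (rule mult_right_mono) simp
    moreover have "C * norm x \<le> \<bar>C\<bar> * norm x"
      by (intro mult_right_mono) auto
    moreover have "s \<bullet> x \<le> norm s * norm x"
      by (rule norm_cauchy_schwarz)
    moreover have "\<bar>g 0\<bar> \<le> \<bar>g 0\<bar> * norm x"
      using mult_left_mono[OF n, of "\<bar>g 0\<bar>"] by simp
    ultimately show ?thesis
      using C[OF n] by (simp add: algebra_simps power2_eq_square)
  qed
  have "continuous_on UNIV ?k"
    using convex by (intro convex_on_continuous) auto
  then have "continuous_on UNIV (\<lambda>x. ?k x + (\<alpha> / 2 * (norm x)\<^sup>2 - s \<bullet> x))"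
    by (rule continuous_on_add) (intro continuous_intros)
  then have "continuous_on (cball 0 R) ?h"
    by (auto intro: continuous_on_subset)
  then obtain x where x: "\<And>y. norm y \<le> R \<Longrightarrow> ?h x \<le> ?h y"
    using continuous_attains_inf[of "cball 0 R" ?h] \<open>R \<ge> 1\<close> by force
  have "?h x \<le> ?h y" for y
    using x[of y] x[of 0] outside[of y] \<open>R \<ge> 1\<close> by (cases "norm y \<le> R") auto
  then have "s \<in> subdifferential g x"
    by (simp add: subdifferential_def inner_diff_right algebra_simps)
  then show ?thesis
    by (rule that)
qed

text \<open>At a point of the segment from \<open>x\<close> to \<open>y\<close>, the subgradient
  bounds \<open>g\<close> from below and strong convexity from above. Dividing by \<open>t\<close>
  and letting \<open>t\<close> tend to 0 leaves the full quadratic term.\<close>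

lemma subgradient_quadratic_growth:
  fixes g :: "'a::real_inner \<Rightarrow> real"
  assumes convex: "convex_on UNIV (\<lambda>x. g x - \<alpha> / 2 * (norm x)\<^sup>2)"
    and s: "s \<in> subdifferential g x"
  shows "g x + s \<bullet> (y - x) + \<alpha> / 2 * (norm (y - x))\<^sup>2 \<le> g y"
proof -
  let ?N = "\<alpha> / 2 * (norm (y - x))\<^sup>2"
  have "g x + s \<bullet> (y - x) + ?N - g y \<le> t * ?N" if t: "0 < t" "t < 1" for t
  proof -
    have "g x + s \<bullet> ((1 - t) *\<^sub>R x + t *\<^sub>R y - x) \<le> g ((1 - t) *\<^sub>R x + t *\<^sub>R y)"
      using s by (simp add: subdifferential_def)
    also have "(1 - t) *\<^sub>R x + t *\<^sub>R y - x = t *\<^sub>R (y - x)"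
      by (simp add: algebra_simps)
    also have "g ((1 - t) *\<^sub>R x + t *\<^sub>R y) \<le> (1 - t) * g x + t * g y - \<alpha> / 2 * (t * (1 - t) * (norm (y - x))\<^sup>2)"
      using strongly_convex_onD[OF convex] t by simp
    finally have "t * (g x + s \<bullet> (y - x) + ?N - g y) \<le> t * (t * ?N)"
      by (simp add: algebra_simps)
    then show ?thesis
      using t by simp
  qed
  then have "g x + s \<bullet> (y - x) + ?N - g y \<le> 0"
    by (rule nonpos_if_le_small_multiples)
  then show ?thesis
    by simp
qed

text \<open>Sum of the growth inequalities at \<open>x\<close> and at \<open>y\<close>.\<close>

lemma subdifferential_strongly_monotone:
  fixes g :: "'a::real_inner \<Rightarrow> real"
  assumes "convex_on UNIV (\<lambda>x. g x - \<alpha> / 2 * (norm x)\<^sup>2)"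
    and "s \<in> subdifferential g x" "r \<in> subdifferential g y"
  shows "\<alpha> * (norm (y - x))\<^sup>2 \<le> (r - s) \<bullet> (y - x)"
  using subgradient_quadratic_growth[OF assms(1,2), of y] subgradient_quadratic_growth[OF assms(1,3), of x]
  by (simp add: norm_minus_commute inner_simps algebra_simps)

lemma inv_subdifferential_eq_singleton:
  fixes g :: "'a::real_inner \<Rightarrow> real"
  assumes convex: "convex_on UNIV (\<lambda>x. g x - \<alpha> / 2 * (norm x)\<^sup>2)" and "\<alpha> > 0"
    and s: "s \<in> subdifferential g x"
  shows "inv_subdifferential g s = {x}"
proof -
  have "y = x" if "s \<in> subdifferential g y" for y
    using subdifferential_strongly_monotone[OF convex s that] \<open>\<alpha> > 0\<close> by (simp add: mult_le_0_iff)
  with s show ?thesis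
    unfolding inv_subdifferential_def by blast
qed

section \<open>Values and gradient of the conjugate\<close>

text \<open>The equality case of the Fenchel-Young inequality: the subgradient inequality says that
  \<open>x\<close> attains the maximum.\<close>

lemma fenchel_conjugate_eq:
  assumes "s \<in> subdifferential g x"
  shows "fenchel_conjugate g s = s \<bullet> x - g x"
  unfolding fenchel_conjugate_def
proof (rule Greatest_equality)
  fix m
  assume "\<exists>y. m = s \<bullet> y - g y"
  then obtain y where "m = s \<bullet> y - g y" ..
  moreover have "g x + s \<bullet> (y - x) \<le> g y"
    using assms by (simp add: subdifferential_def)
  ultimately show "m \<le> s \<bullet> x - g x"
    by (simp add: inner_diff_right)
qed blast

text \<open>With \<open>y\<close> the maximizer for \<open>s + h\<close>, testing \<open>x\<close>
  in the maximum at \<open>s + h\<close> gives remainder at least 0, and testing \<open>y\<close> in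
  the maximum at \<open>s\<close> gives at most \<open>h \<bullet> (y - x)\<close>.\<close>

lemma fenchel_conjugate_remainder:
  fixes g :: "'a::euclidean_space \<Rightarrow> real"
  assumes convex: "convex_on UNIV (\<lambda>x. g x - \<alpha> / 2 * (norm x)\<^sup>2)" and "\<alpha> > 0"
    and s: "s \<in> subdifferential g x"
  shows "\<bar>fenchel_conjugate g (s + h) - fenchel_conjugate g s - h \<bullet> x\<bar> \<le> 1 / \<alpha> * (norm h)\<^sup>2"
proof -
  obtain y where y: "s + h \<in> subdifferential g y"
    using subdifferential_surj[OF convex \<open>\<alpha> > 0\<close>] by blast
  let ?rem = "fenchel_conjugate g (s + h) - fenchel_conjugate g s - h \<bullet> x"
  have rem: "?rem = (s + h) \<bullet> y - g y - (s \<bullet> x - g x) - h \<bullet> x"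
    using fenchel_conjugate_eq[OF s] fenchel_conjugate_eq[OF y] by simp
  have "g y + (s + h) \<bullet> (x - y) \<le> g x" "g x + s \<bullet> (y - x) \<le> g y"
    using s y by (auto simp: subdifferential_def)
  then have "0 \<le> ?rem" and upper: "?rem \<le> h \<bullet> (y - x)"
    unfolding rem by (auto simp: inner_simps algebra_simps)
  have cs: "h \<bullet> (y - x) \<le> norm h * norm (y - x)"
    by (rule norm_cauchy_schwarz)
  moreover have "\<alpha> * (norm (y - x))\<^sup>2 \<le> h \<bullet> (y - x)"
    using subdifferential_strongly_monotone[OF convex s y] by simp
  ultimately have "\<alpha> * norm (y - x) * norm (y - x) \<le> norm h * norm (y - x)"
    by (simp add: power2_eq_square)
  \<comment> \<open>The inverse subdifferential is Lipschitz with constant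
    \<open>1 / \<alpha>\<close>; the case \<open>y = x\<close> is split off to cancel
    \<open>norm (y - x)\<close>.\<close>
  then have "norm (y - x) \<le> norm h / \<alpha>"
    using \<open>\<alpha> > 0\<close> by (cases "y = x") (auto simp: pos_le_divide_eq mult.commute)
  then have "norm h * norm (y - x) \<le> norm h * (norm h / \<alpha>)"
    by (intro mult_left_mono) auto
  with \<open>0 \<le> ?rem\<close> upper cs show ?thesis
    by (simp add: power2_eq_square)
qed

lemma GDERIV_fenchel_conjugate:
  fixes g :: "'a::euclidean_space \<Rightarrow> real"
  assumes "convex_on UNIV (\<lambda>x. g x - \<alpha> / 2 * (norm x)\<^sup>2)" "\<alpha> > 0" "s \<in> subdifferential g x"
  shows "GDERIV (fenchel_conjugate g) s :> x"
  using GDERIV_if_quadratic_remainder[OF fenchel_conjugate_remainder[OF assms]] .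

section \<open>Duality between the two problems\<close>

text \<open>First-order optimality: a step from \<open>w\<close> towards \<open>u\<close> stays in
  the hull and cannot decrease the conjugate at the negated point, whose gradient at
  \<open>- w\<close> is \<open>x\<close>.\<close>

lemma dual_optimal_supports:
  fixes g :: "'a::euclidean_space \<Rightarrow> real"
  assumes convex: "convex_on UNIV (\<lambda>x. g x - \<alpha> / 2 * (norm x)\<^sup>2)" and "\<alpha> > 0"
    and dual: "dual_optimal g V w" and x: "- w \<in> subdifferential g x" and u: "u \<in> convex hull V"
  shows "u \<bullet> x \<le> w \<bullet> x"
proof -
  have w: "w \<in> convex hull V"
    and opt: "\<And>z. z \<in> convex hull V \<Longrightarrow> fenchel_conjugate g (- w) \<le> fenchel_conjugate g (- z)"
    using dual by (force simp: dual_optimal_def is_arg_max_def)+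
  have "(u - w) \<bullet> x \<le> t * (1 / \<alpha> * (norm (u - w))\<^sup>2)" if t: "0 < t" "t < 1" for t
  proof -
    have "(1 - t) *\<^sub>R w + t *\<^sub>R u \<in> convex hull V"
      using convexD_alt[OF convex_convex_hull w u] t by simp
    moreover have "- ((1 - t) *\<^sub>R w + t *\<^sub>R u) = - w + - (t *\<^sub>R (u - w))"
      by (simp add: algebra_simps)
    ultimately have "fenchel_conjugate g (- w) \<le> fenchel_conjugate g (- w + - (t *\<^sub>R (u - w)))"
      using opt by metis
    moreover have "\<bar>fenchel_conjugate g (- w + - (t *\<^sub>R (u - w))) - fenchel_conjugate g (- w)
        - (- (t *\<^sub>R (u - w))) \<bullet> x\<bar> \<le> 1 / \<alpha> * (norm (- (t *\<^sub>R (u - w))))\<^sup>2"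
      by (rule fenchel_conjugate_remainder[OF convex \<open>\<alpha> > 0\<close> x])
    moreover have "(- (t *\<^sub>R (u - w))) \<bullet> x = - (t * ((u - w) \<bullet> x))"
      by simp
    moreover have "1 / \<alpha> * (norm (- (t *\<^sub>R (u - w))))\<^sup>2 = t * (t * (1 / \<alpha> * (norm (u - w))\<^sup>2))"
      by (simp add: power_mult_distrib power2_eq_square)
    ultimately have "t * ((u - w) \<bullet> x) \<le> t * (t * (1 / \<alpha> * (norm (u - w))\<^sup>2))"
      by linarith
    then show ?thesis
      by (rule mult_left_le_imp_le) (use t in simp)
  qed
  then have "(u - w) \<bullet> x \<le> 0"
    by (rule nonpos_if_le_small_multiples)
  then show ?thesis
    by (simp add: inner_diff_left)
qed

lemma inner_le_if_in_convex_hull: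
  assumes "\<And>v. v \<in> V \<Longrightarrow> v \<bullet> y \<le> t" and "w \<in> convex hull V"
  shows "w \<bullet> y \<le> t"
proof -
  have "convex hull V \<subseteq> {v. y \<bullet> v \<le> t}"
    using assms(1) by (intro hull_minimal convex_halfspace_le) (auto simp: inner_commute)
  with assms(2) show ?thesis
    by (auto simp: inner_commute)
qed

text \<open>Feasibility gives \<open>w \<bullet> y \<le> t\<close>, the support property bounds the
  maximum by \<open>w \<bullet> x\<close>, and growth of \<open>g\<close> with subgradient
  \<open>- w\<close> links the two. The quadratic surplus yields uniqueness.\<close>

lemma primal_quadratic_growth:
  fixes g :: "'a::euclidean_space \<Rightarrow> real"
  assumes convex: "convex_on UNIV (\<lambda>x. g x - \<alpha> / 2 * (norm x)\<^sup>2)" and "\<alpha> > 0"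
    and V: "finite V" "V \<noteq> {}"
    and dual: "dual_optimal g V w" and x: "- w \<in> subdifferential g x"
    and feasible: "\<And>v. v \<in> V \<Longrightarrow> v \<bullet> y \<le> t"
  shows "g x + (MAX v\<in>V. v \<bullet> x) + \<alpha> / 2 * (norm (y - x))\<^sup>2 \<le> g y + t"
proof -
  have "w \<in> convex hull V"
    using dual by (simp add: dual_optimal_def is_arg_max_def)
  then have "w \<bullet> y \<le> t"
    using feasible by (rule inner_le_if_in_convex_hull[rotated])
  moreover have "(MAX v\<in>V. v \<bullet> x) \<le> w \<bullet> x"
    using V dual_optimal_supports[OF convex \<open>\<alpha> > 0\<close> dual x] by (auto intro: hull_inc)
  moreover have "g x + (- w) \<bullet> (y - x) + \<alpha> / 2 * (norm (y - x))\<^sup>2 \<le> g y"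
    by (rule subgradient_quadratic_growth[OF convex x])
  ultimately show ?thesis
    by (simp add: inner_simps)
qed

lemma primal_optimal_if_dual_optimal:
  fixes g :: "'a::euclidean_space \<Rightarrow> real"
  assumes "convex_on UNIV (\<lambda>x. g x - \<alpha> / 2 * (norm x)\<^sup>2)" "\<alpha> > 0"
    and V: "finite V" "V \<noteq> {}"
    and "dual_optimal g V w" "- w \<in> subdifferential g x"
  shows "primal_optimal g V (x, MAX v\<in>V. v \<bullet> x)"
proof -
  have "g x + (MAX v\<in>V. v \<bullet> x) \<le> g y + t" if "\<forall>v\<in>V. v \<bullet> y \<le> t" for y t
  proof -
    have "0 \<le> \<alpha> / 2 * (norm (y - x))\<^sup>2"
      using \<open>\<alpha> > 0\<close> by simp
    then show ?thesis
      using primal_quadratic_growth[OF assms, of y t] that by auto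
  qed
  then show ?thesis
    using V by (force simp: primal_optimal_def is_arg_min_def not_less)
qed

lemma primal_solution_unique:
  fixes g :: "'a::euclidean_space \<Rightarrow> real"
  assumes "convex_on UNIV (\<lambda>x. g x - \<alpha> / 2 * (norm x)\<^sup>2)" "\<alpha> > 0"
    and V: "finite V" "V \<noteq> {}"
    and "dual_optimal g V w" "- w \<in> subdifferential g x"
    and primal: "primal_optimal g V (y, t)"
  shows "y = x"
proof -
  have feasible: "\<forall>v\<in>V. v \<bullet> y \<le> t"
    and opt: "\<And>z r. \<forall>v\<in>V. v \<bullet> z \<le> r \<Longrightarrow> g y + t \<le> g z + r"
    using primal by (force simp: primal_optimal_def is_arg_min_def not_less)+
  have "g y + t \<le> g x + (MAX v\<in>V. v \<bullet> x)"
    using V by (intro opt) auto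
  moreover have "g x + (MAX v\<in>V. v \<bullet> x) + \<alpha> / 2 * (norm (y - x))\<^sup>2 \<le> g y + t"
    using primal_quadratic_growth[OF assms(1-6)] feasible by blast
  ultimately have "\<alpha> / 2 * (norm (y - x))\<^sup>2 \<le> 0"
    by linarith
  then show ?thesis
    using \<open>\<alpha> > 0\<close> by (simp add: mult_le_0_iff)
qed

text \<open>Every \<open>s\<close> is a subgradient somewhere, so the conjugate is differentiable,
  hence continuous, everywhere; the hull of a finite set is compact.\<close>

lemma dual_optimal_exists:
  fixes g :: "'a::euclidean_space \<Rightarrow> real"
  assumes convex: "convex_on UNIV (\<lambda>x. g x - \<alpha> / 2 * (norm x)\<^sup>2)" and "\<alpha> > 0"
    and "finite V" "V \<noteq> {}"
  obtains w where "dual_optimal g V w"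
proof -
  have "isCont (fenchel_conjugate g) s" for s
    using subdifferential_surj[OF convex \<open>\<alpha> > 0\<close>, of s] GDERIV_fenchel_conjugate[OF convex \<open>\<alpha> > 0\<close>]
    by (metis gderiv_def has_derivative_continuous)
  then have "continuous_on UNIV (fenchel_conjugate g)"
    by (simp add: continuous_at_imp_continuous_on)
  then have "continuous_on (convex hull V) (\<lambda>w. fenchel_conjugate g (- w))"
    by (rule continuous_on_compose2) (intro continuous_intros, simp)
  moreover have "compact (convex hull V)"
    using \<open>finite V\<close> by (rule finite_imp_compact_convex_hull)
  ultimately obtain w where "w \<in> convex hull V"
      "\<And>z. z \<in> convex hull V \<Longrightarrow> fenchel_conjugate g (- w) \<le> fenchel_conjugate g (- z)"
    using continuous_attains_inf \<open>V \<noteq> {}\<close> by (metis convex_hull_eq_empty)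
  then have "dual_optimal g V w"
    by (auto simp: dual_optimal_def is_arg_max_def not_less)
  then show ?thesis
    by (rule that)
qed

section \<open>Smoothness and differentiability\<close>

text \<open>\<open>smooth\<close> itself does not assert differentiability. The subgradient bounds
  the remainder from below and concavity up to a quadratic bounds it from above.\<close>

lemma GDERIV_if_subgradient_smooth:
  fixes g :: "'a::real_inner \<Rightarrow> real"
  assumes "smooth g" and s: "s \<in> subdifferential g x"
  shows "GDERIV g x :> s"
proof -
  obtain \<beta> where "\<beta> > 0" and concave: "concave_on UNIV (\<lambda>x. g x - \<beta> / 2 * (norm x)\<^sup>2)"
    using \<open>smooth g\<close> by (auto simp: smooth_def)
  \<comment> \<open>Smoothness of \<open>g\<close> is read as convexity of \<open>- g\<close> with
    modulus \<open>- \<beta>\<close>.\<close>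
  have "convex_on UNIV (\<lambda>x. - g x - (- \<beta>) / 2 * (norm x)\<^sup>2)"
    using concave by (simp add: concave_on_def algebra_simps)
  note mid = strongly_convex_onD[OF this, of "1 / 2"]
  show ?thesis
  proof (rule GDERIV_if_quadratic_remainder)
    fix h
    have sub: "g x + s \<bullet> h \<le> g (x + h)" "g x - s \<bullet> h \<le> g (x - h)"
      using s[unfolded subdifferential_def, simplified, rule_format, of "x + h"]
        s[unfolded subdifferential_def, simplified, rule_format, of "x - h"]
      by auto
    have "(1 - 1 / 2) *\<^sub>R (x - h) + (1 / 2) *\<^sub>R (x + h) = (1 / 2 + 1 / 2) *\<^sub>R x"
      unfolding scaleR_left_distrib by (simp add: algebra_simps)
    moreover have "norm (x + h - (x - h)) = 2 * norm h"
      using norm_scaleR[of 2 h] by (simp add: scaleR_2)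
    \<comment> \<open>The midpoint inequality turns the lower bound at \<open>x - h\<close> into an upper bound at \<open>x + h\<close>.\<close>
    ultimately have "g (x + h) + g (x - h) \<le> 2 * g x + \<beta> * (norm h)\<^sup>2"
      using mid[of "x - h" "x + h"] by (simp add: power_mult_distrib)
    with sub show "\<bar>g (x + h) - g x - h \<bullet> s\<bar> \<le> \<beta> * (norm h)\<^sup>2"
      by (simp add: inner_commute abs_le_iff)
  qed
qed

section \<open>Finiteness of the vertex set\<close>

text \<open>Each constraint is linear, given by the indicator vector of \<open>A\<close>, and there
  are only finitely many sets \<open>A\<close>.\<close>

lemma polyhedron_base_polytope: "polyhedron (base_polytope F)"
proof -
  define ind :: "'a set \<Rightarrow> real ^ 'a" where "ind A = (\<chi> k. if k \<in> A then 1 else 0)" for A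
  have ind: "(\<Sum>k\<in>A. w $ k) = ind A \<bullet> w" for A w
    by (simp add: ind_def inner_vec_def if_distrib[of "\<lambda>c. c * _"] sum.If_cases cong: if_cong)
  have "base_polytope F = (\<Inter>A. {w. ind A \<bullet> w \<le> F A}) \<inter> {w. ind UNIV \<bullet> w = F UNIV}"
    by (auto simp: base_polytope_def ind)
  also have "polyhedron \<dots>"
    by (intro polyhedron_Int polyhedron_Inter polyhedron_hyperplane) (auto intro: polyhedron_halfspace_le)
  finally show ?thesis .
qed

text \<open>This makes \<open>V\<close> finite, which gives the \<open>MAX\<close> over
  \<open>V\<close> its meaning and the hull its compactness.\<close>

lemma finite_vert_base_polytope: "finite (vert (base_polytope F))"
  unfolding vert_def by (rule finite_polyhedron_extreme_points[OF polyhedron_base_polytope])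

theorem theorem4p3:
  fixes F :: "'n::finite set \<Rightarrow> real"
    and V :: "(real ^ 'n) set"
    and g :: "real ^ 'n \<Rightarrow> real"
  assumes "submodular F"
    and "F {} = 0"
    and "V \<noteq> {}"
    and "V \<subseteq> vert (base_polytope F)"
    and "strongly_convex g"
  shows "(\<forall>w. dual_optimal g V w \<longrightarrow>
            (\<exists>x. inv_subdifferential g (- w) = {x}
               \<and> GDERIV (fenchel_conjugate g) (- w) :> x
               \<and> primal_optimal g V (x, MAX v\<in>V. v \<bullet> x)))
       \<and> (smooth g \<longrightarrow>
            (\<forall>x t. primal_optimal g V (x, t) \<longrightarrow>
               (\<exists>d. GDERIV g x :> d \<and> dual_optimal g V (- d))))"
proof -
  have V: "finite V" "V \<noteq> {}"
    using assms finite_subset[OF _ finite_vert_base_polytope] by auto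
  obtain \<alpha> where "\<alpha> > 0" and convex: "convex_on UNIV (\<lambda>x. g x - \<alpha> / 2 * (norm x)\<^sup>2)"
    using \<open>strongly_convex g\<close> by (auto simp: strongly_convex_def)
  note g = convex \<open>\<alpha> > 0\<close>
  show ?thesis
  proof (intro conjI allI impI)
    fix w
    assume dual: "dual_optimal g V w"
    obtain x where x: "- w \<in> subdifferential g x"
      using subdifferential_surj[OF g] by blast
    show "\<exists>x. inv_subdifferential g (- w) = {x} \<and> GDERIV (fenchel_conjugate g) (- w) :> x
        \<and> primal_optimal g V (x, MAX v\<in>V. v \<bullet> x)"
      using inv_subdifferential_eq_singleton[OF g x] GDERIV_fenchel_conjugate[OF g x]
        primal_optimal_if_dual_optimal[OF g V dual x] by blast
  next
    fix x t
    assume "smooth g" and primal: "primal_optimal g V (x, t)"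
    \<comment> \<open>An arbitrary dual optimum suffices: the primal solution \<open>y\<close> that
      it induces must coincide with \<open>x\<close>, so \<open>- w\<close> is a subgradient at
      \<open>x\<close> and therefore the gradient.\<close>
    obtain w where dual: "dual_optimal g V w"
      using dual_optimal_exists[OF g V] by blast
    obtain y where y: "- w \<in> subdifferential g y"
      using subdifferential_surj[OF g] by blast
    have "x = y"
      using primal_solution_unique[OF g V dual y primal] .
    then have "GDERIV g x :> - w"
      using GDERIV_if_subgradient_smooth[OF \<open>smooth g\<close> y] by simp
    with dual show "\<exists>d. GDERIV g x :> d \<and> dual_optimal g V (- d)"
      by (intro exI[of _ "- w"]) simp
  qed
qed

end
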